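(* Let $\alpha=[a_0;a_1,\ldots,a_m,\overline{a_{m+1},\ldots,a_{m+h}}]$ for some integer $m\ge0$ and positive integer $h$ (a regular continued fraction whose terms from index $m+1$ on repeat with period $h$). (i) If $m=0$; or $m$ is odd and $a_m<a_{m+h}$; or $m$ is even, nonzero and $a_m>a_{m+h}$, then $\alpha$ has only finitely many best upper approximations of the third kind. (ii) If $m$ is odd and $a_m>a_{m+h}$; or $m$ is even, nonzero and $a_m<a_{m+h}$, then $\alpha$ has only finitely many best lower approximations of the third kind. (iii) A quadratic irrational number cannot have simultaneously infinitely many best lower approximations of the third kind and infinitely many best upper approximations of the third kind.
   Context: For $p\in\mathbb{Z}$, $q\in\mathbb{N}$, the fraction $\frac{p}{q}$ is a best lower approximation of the third kind to $\alpha$ if $0\le q^{2}(\alpha-\frac{p}{q})<(q')^{2}(\alpha-\frac{p'}{q'})$ for all $p'\in\mathbb{Z}$, $q'\in\mathbb{N}$ with $\frac{p'}{q'}\le\alpha$, $\frac{p'}{q'}\ne\frac{p}{q}$ and $q'\le q$; it is a best upper approximation of the third kind if $0\le q^{2}(\frac{p}{q}-\alpha)<(q')^{2}(\frac{p'}{q'}-\alpha)$ for all $p'\in\mathbb{Z}$, $q'\in\mathbb{N}$ with $\frac{p'}{q'}\ge\alpha$, $\frac{p'}{q'}\ne\frac{p}{q}$ and $q'\le q$. $[a_0;a_1,\ldots]$ denotes a regular continued fraction ($a_0\in\mathbb{Z}$, $a_j\in\mathbb{N}$). A quadratic irrational is an irrational root of a polynomial $x^2+ux+v$ with $u,v\in\mathbb{Q}$.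 *)

theory Defs
  imports Complex_Main
begin

text \<open>\<open>\<nat>\<close> stands for the positive integers: denominators and partial quotients of index at
  least 1 are positive.\<close>

definition best_lower_approx3 :: "real \<Rightarrow> int \<Rightarrow> nat \<Rightarrow> bool" where
  "best_lower_approx3 \<alpha> p q \<longleftrightarrow>
     q > 0 \<and> 0 \<le> (real q)\<^sup>2 * (\<alpha> - real_of_int p / real q) \<and>
     (\<forall>p' q'. q' > 0 \<longrightarrow> real_of_int p' / real q' \<le> \<alpha> \<longrightarrow>
        real_of_int p' / real q' \<noteq> real_of_int p / real q \<longrightarrow> q' \<le> q \<longrightarrow>
        (real q)\<^sup>2 * (\<alpha> - real_of_int p / real q) < (real q')\<^sup>2 * (\<alpha> - real_of_int p' / real q'))"

definition best_upper_approx3 :: "real \<Rightarrow> int \<Rightarrow> nat \<Rightarrow> bool" where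
  "best_upper_approx3 \<alpha> p q \<longleftrightarrow>
     q > 0 \<and> 0 \<le> (real q)\<^sup>2 * (real_of_int p / real q - \<alpha>) \<and>
     (\<forall>p' q'. q' > 0 \<longrightarrow> real_of_int p' / real q' \<ge> \<alpha> \<longrightarrow>
        real_of_int p' / real q' \<noteq> real_of_int p / real q \<longrightarrow> q' \<le> q \<longrightarrow>
        (real q)\<^sup>2 * (real_of_int p / real q - \<alpha>) < (real q')\<^sup>2 * (real_of_int p' / real q' - \<alpha>))"

text \<open>Approximations are counted as fractions, i.e. by their value: \<open>p / q\<close> and
  \<open>(k * p) / (k * q)\<close> are the same approximation.\<close>

definition best_lower_approxs3 :: "real \<Rightarrow> real set" where
  "best_lower_approxs3 \<alpha> = {real_of_int p / real q | p q. best_lower_approx3 \<alpha> p q}"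

definition best_upper_approxs3 :: "real \<Rightarrow> real set" where
  "best_upper_approxs3 \<alpha> = {real_of_int p / real q | p q. best_upper_approx3 \<alpha> p q}"

text \<open>The value of the finite continued fraction \<open>[a 0; a 1, \<dots>, a n]\<close>.\<close>

primrec cfrac_convergent :: "(nat \<Rightarrow> int) \<Rightarrow> nat \<Rightarrow> real" where
  "cfrac_convergent a 0 = real_of_int (a 0)"
| "cfrac_convergent a (Suc n) =
     real_of_int (a 0) + 1 / cfrac_convergent (\<lambda>k. a (Suc k)) n"

text \<open>\<open>\<alpha> = [a 0; a 1, a 2, \<dots>]\<close> as an infinite regular continued fraction.\<close>

definition regular_cfrac :: "(nat \<Rightarrow> int) \<Rightarrow> real \<Rightarrow> bool" where
  "regular_cfrac a \<alpha> \<longleftrightarrow> (\<forall>j\<ge>1. a j \<ge> 1) \<and> cfrac_convergent a \<longlonglongrightarrow> \<alpha>"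

text \<open>\<open>\<alpha>\<close> is the regular continued fraction with preperiod \<open>a 0, \<dots>, a m\<close> and repeating block
  \<open>a (m + 1), \<dots>, a (m + h)\<close>; neither \<open>m\<close> nor \<open>h\<close> need be minimal.\<close>

definition periodic_cfrac :: "(nat \<Rightarrow> int) \<Rightarrow> nat \<Rightarrow> nat \<Rightarrow> real \<Rightarrow> bool" where
  "periodic_cfrac a m h \<alpha> \<longleftrightarrow> regular_cfrac a \<alpha> \<and> h > 0 \<and> (\<forall>j>m. a (j + h) = a j)"

definition quadratic_irrational :: "real \<Rightarrow> bool" where
  "quadratic_irrational \<alpha> \<longleftrightarrow> \<alpha> \<notin> \<rat> \<and> (\<exists>u\<in>\<rat>. \<exists>v\<in>\<rat>. \<alpha>\<^sup>2 + u * \<alpha> + v = 0)"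

end

theory Submission
  imports Defs
begin

text \<open>If \<open>\<alpha>\<close> and \<open>\<beta>\<close> are conjugate, some positive multiple \<open>D\<close> makes
  \<open>D (p - q \<alpha>) (p - q \<beta>)\<close> integral, so on the fractions above \<open>\<alpha>\<close> this form attains a minimum
  \<open>N\<^sub>0\<close>, say at \<open>p\<^sub>0 / q\<^sub>0\<close>. Since \<open>q\<^sup>2 (p / q - \<alpha>)\<close> is the form divided by \<open>p / q - \<beta>\<close>, if
  \<open>\<beta> < \<alpha>\<close> then no other fraction with \<open>q \<ge> q\<^sub>0\<close> can beat \<open>p\<^sub>0 / q\<^sub>0\<close>: a fraction beating it would
  have to be larger than \<open>p\<^sub>0 / q\<^sub>0\<close>, which is absurd. Thus \<open>\<beta> < \<alpha>\<close> leaves only finitely many best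
  upper approximations, and by reflection \<open>\<alpha> < \<beta>\<close> only finitely many best lower ones. It remains to
  locate the conjugate of a periodic continued fraction. The conjugates of its complete quotients
  satisfy the same recurrence; in the periodic part they lie in \<open>]-1, 0[\<close>, and from there the signs
  are followed back to index \<open>0\<close>.\<close>

section \<open>Best approximations and the conjugate\<close>

text \<open>This says that \<open>x\<close> and \<open>y\<close> are the two roots of a monic
  rational quadratic. Rational pairs and \<open>x = y\<close> may satisfy it too, so the order of
  the two is a separate condition below.\<close>

definition conj_rat :: "real \<Rightarrow> real \<Rightarrow> bool" where
  "conj_rat x y \<longleftrightarrow> x + y \<in> \<rat> \<and> x * y \<in> \<rat>"

lemma rats_common_denominator:
  fixes s t :: real
  assumes "s \<in> \<rat>" "t \<in> \<rat>"
  obtains D :: nat where "D > 0" "real D * s \<in> \<int>" "real D * t \<in> \<int>"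
proof -
  from assms(1) obtain a b where ab: "b > 0" "s = real_of_int a / real_of_int b"
    by (elim Rats_cases') auto
  from assms(2) obtain c d where cd: "d > 0" "t = real_of_int c / real_of_int d"
    by (elim Rats_cases') auto
  have "real (nat (b * d)) = real_of_int b * real_of_int d"
    using ab(1) cd(1) by simp
  then have "real (nat (b * d)) * s = real_of_int (a * d)" "real (nat (b * d)) * t = real_of_int (c * b)"
    using ab cd by auto
  then have "real (nat (b * d)) * s \<in> \<int>" "real (nat (b * d)) * t \<in> \<int>"
    by (metis Ints_of_int)+
  moreover have "nat (b * d) > 0"
    using ab(1) cd(1) by simp
  ultimately show thesis
    using that by blast
qed

text \<open>Disposes of the approximations whose denominator is below that of the minimising
  fraction.\<close>

lemma finite_fractions_bounded:
  fixes l u :: real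
  shows "finite {real_of_int p / real q | p q. 0 < q \<and> q < n \<and> l \<le> real_of_int p / real q \<and>
    real_of_int p / real q \<le> u}" (is "finite ?F")
proof -
  define B where "B = (\<bar>l\<bar> + \<bar>u\<bar>) * real n"
  have "?F \<subseteq> (\<lambda>(p, q). real_of_int p / real q) ` ({-\<lceil>B\<rceil>..\<lceil>B\<rceil>} \<times> {..<n})"
  proof
    fix z assume "z \<in> ?F"
    then obtain p q where z: "z = real_of_int p / real q" and q: "0 < q" "q < n"
      and b: "l \<le> real_of_int p / real q" "real_of_int p / real q \<le> u"
      by blast
    have "\<bar>z\<bar> \<le> \<bar>l\<bar> + \<bar>u\<bar>"
      using b z by linarith
    then have "\<bar>z\<bar> * real q \<le> (\<bar>l\<bar> + \<bar>u\<bar>) * real n"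
      using q by (intro mult_mono) auto
    moreover have "\<bar>z\<bar> * real q = \<bar>real_of_int p\<bar>"
      using z q by (simp add: abs_mult)
    ultimately have "\<bar>real_of_int p\<bar> \<le> B"
      unfolding B_def by simp
    then have "p \<in> {-\<lceil>B\<rceil>..\<lceil>B\<rceil>}"
      by (simp add: abs_le_iff) linarith
    then show "z \<in> (\<lambda>(p, q). real_of_int p / real q) ` ({-\<lceil>B\<rceil>..\<lceil>B\<rceil>} \<times> {..<n})"
      using z q by (intro image_eqI[of _ _ "(p, q)"]) auto
  qed
  then show ?thesis
    by (rule finite_subset) simp
qed

text \<open>The competitor behind the second bound is the ceiling of \<alpha> with denominator 1, at
  distance less than 1 from \<alpha>.\<close>

lemma best_upper_approx3_bounds:
  assumes "best_upper_approx3 \<alpha> p q"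
  shows "\<alpha> \<le> real_of_int p / real q" "real_of_int p / real q \<le> \<alpha> + 1"
proof -
  have q: "q > 0" and nn: "0 \<le> (real q)\<^sup>2 * (real_of_int p / real q - \<alpha>)"
    using assms unfolding best_upper_approx3_def by auto
  show ge: "\<alpha> \<le> real_of_int p / real q"
    using nn q by (simp add: zero_le_mult_iff)
  show "real_of_int p / real q \<le> \<alpha> + 1"
  proof (cases "real_of_int \<lceil>\<alpha>\<rceil> = real_of_int p / real q")
    case True
    then show ?thesis by linarith
  next
    case False
    have "1 * (real_of_int p / real q - \<alpha>) \<le> (real q)\<^sup>2 * (real_of_int p / real q - \<alpha>)"
      using q ge by (intro mult_right_mono) auto
    also have "\<dots> < real_of_int \<lceil>\<alpha>\<rceil> - \<alpha>"
      using False assms q unfolding best_upper_approx3_def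
      by (auto dest!: conjunct2 spec[of _ "\<lceil>\<alpha>\<rceil>"] dest: spec[of _ "1 :: nat"])
    also have "\<dots> < 1"
      by linarith
    finally show ?thesis by simp
  qed
qed

lemma finite_best_upper_approxs3:
  assumes "conj_rat \<alpha> \<beta>" "\<beta> < \<alpha>"
  shows "finite (best_upper_approxs3 \<alpha>)"
proof -
  obtain D :: nat where D: "D > 0" "real D * (\<alpha> + \<beta>) \<in> \<int>" "real D * (\<alpha> * \<beta>) \<in> \<int>"
    using assms(1) rats_common_denominator unfolding conj_rat_def by metis
  define N where "N p q = (real_of_int p - real q * \<alpha>) * (real_of_int p - real q * \<beta>)"
    for p :: int and q :: nat
  have N_int: "real D * N p q \<in> \<int>" for p q
  proof -
    have "real D * N p q = real D * (real_of_int p)\<^sup>2 - (real D * (\<alpha> + \<beta>)) * real_of_int p * real q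
        + (real D * (\<alpha> * \<beta>)) * (real q)\<^sup>2"
      unfolding N_def by (simp add: algebra_simps power2_eq_square)
    then show ?thesis
      using D by simp
  qed
  have N_eq: "N p q = (real q)\<^sup>2 * (real_of_int p / real q - \<alpha>) * (real_of_int p / real q - \<beta>)"
    if "q > 0" for p q
    using that unfolding N_def by (simp add: field_simps power2_eq_square)
  have N_pos: "N p q > 0" if "q > 0" "\<alpha> < real_of_int p / real q" for p q
    unfolding N_eq[OF that(1)] using that assms(2) by auto
  \<comment> \<open>Strictly above \<alpha> the form \<open>N\<close> is positive, so
    \<open>real D * N p q\<close> is a positive integer there, the passage to \<open>nat\<close>
    loses nothing, and a minimum exists.\<close>
  define above where "above r \<longleftrightarrow> snd r > 0 \<and> \<alpha> < real_of_int (fst r) / real (snd r)"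
    for r :: "int \<times> nat"
  have "above (\<lfloor>\<alpha>\<rfloor> + 1, 1)"
    unfolding above_def by simp
  then obtain r0 where "above r0"
    and min: "\<And>r. above r \<Longrightarrow>
      nat \<lfloor>real D * N (fst r0) (snd r0)\<rfloor> \<le> nat \<lfloor>real D * N (fst r) (snd r)\<rfloor>"
    using ex_has_least_nat[of above _ "\<lambda>r. nat \<lfloor>real D * N (fst r) (snd r)\<rfloor>"]
    by metis
  define p0 q0 where "p0 = fst r0" and "q0 = snd r0"
  define z0 where "z0 = real_of_int p0 / real q0"
  have q0: "q0 > 0" and z0: "\<alpha> < z0"
    using \<open>above r0\<close> unfolding above_def p0_def q0_def z0_def by auto
  have N_min: "N p0 q0 \<le> N p q" if "q > 0" "\<alpha> < real_of_int p / real q" for p q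
  proof -
    have "nat \<lfloor>real D * N p0 q0\<rfloor> \<le> nat \<lfloor>real D * N p q\<rfloor>"
      using min[of "(p, q)"] that unfolding above_def p0_def q0_def by simp
    moreover have "real D * N p q > 0"
      using N_pos[OF that] D(1) by simp
    ultimately have "\<lfloor>real D * N p0 q0\<rfloor> \<le> \<lfloor>real D * N p q\<rfloor>"
      by linarith
    then have "real D * N p0 q0 \<le> real D * N p q"
      using N_int[of p0 q0] N_int[of p q] by (elim Ints_cases) simp
    then show ?thesis
      using D(1) by simp
  qed
  \<comment> \<open>The value \<alpha> itself occurs only for rational \<alpha>; \<open>N\<close>
    vanishes there, so the minimum says nothing about it.\<close>
  have no_record: "real_of_int p / real q = \<alpha> \<or> real_of_int p / real q = z0"
    if best: "best_upper_approx3 \<alpha> p q" and "q0 \<le> q" for p q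
  proof (rule ccontr)
    define z where "z = real_of_int p / real q"
    assume "\<not> (real_of_int p / real q = \<alpha> \<or> real_of_int p / real q = z0)"
    then have ne: "z \<noteq> \<alpha>" "z \<noteq> z0"
      unfolding z_def by auto
    have z: "\<alpha> < z"
      using best_upper_approx3_bounds(1)[OF best] ne(1) unfolding z_def by simp
    have q: "q > 0"
      using q0 \<open>q0 \<le> q\<close> by simp
    have lt: "(real q)\<^sup>2 * (z - \<alpha>) < (real q0)\<^sup>2 * (z0 - \<alpha>)"
      using best q0 z0 ne(2) \<open>q0 \<le> q\<close> unfolding best_upper_approx3_def z_def z0_def by simp
    have "N p0 q0 \<le> N p q"
      using N_min[OF q] z unfolding z_def by simp
    then have "(real q0)\<^sup>2 * (z0 - \<alpha>) * (z0 - \<beta>) \<le> (real q)\<^sup>2 * (z - \<alpha>) * (z - \<beta>)"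
      unfolding N_eq[OF q0] N_eq[OF q] z_def z0_def .
    also have "\<dots> < (real q0)\<^sup>2 * (z0 - \<alpha>) * (z - \<beta>)"
      using lt z assms(2) by (intro mult_strict_right_mono) auto
    \<comment> \<open>Cancelling the positive common factor leaves
      \<open>z0 - \<beta> < z - \<beta>\<close>. A larger fraction with denominator at least
      \<open>q0\<close> has no smaller scaled error, against \<open>lt\<close>.\<close>
    finally have "z0 < z"
      using q0 z0 by simp
    then have "(real q0)\<^sup>2 * (z0 - \<alpha>) \<le> (real q)\<^sup>2 * (z - \<alpha>)"
      using \<open>q0 \<le> q\<close> z0 by (intro mult_mono power_mono) auto
    then show False
      using lt by simp
  qed
  have "best_upper_approxs3 \<alpha> \<subseteq> {\<alpha>, z0} \<union> {real_of_int p / real q | p q.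
      0 < q \<and> q < q0 \<and> \<alpha> \<le> real_of_int p / real q \<and> real_of_int p / real q \<le> \<alpha> + 1}"
  proof
    fix z assume "z \<in> best_upper_approxs3 \<alpha>"
    then obtain p q where z: "z = real_of_int p / real q" and best: "best_upper_approx3 \<alpha> p q"
      unfolding best_upper_approxs3_def by blast
    show "z \<in> {\<alpha>, z0} \<union> {real_of_int p / real q | p q.
        0 < q \<and> q < q0 \<and> \<alpha> \<le> real_of_int p / real q \<and> real_of_int p / real q \<le> \<alpha> + 1}"
    proof (cases "q0 \<le> q")
      case True
      then show ?thesis
        using no_record[OF best] z by auto
    next
      case False
      moreover have "q > 0"
        using best unfolding best_upper_approx3_def by simp
      ultimately show ?thesis
        using best_upper_approx3_bounds[OF best] z by (intro UnI2 CollectI exI[of _ p] exI[of _ q]) auto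
    qed
  qed
  then show ?thesis
    by (rule finite_subset) (simp add: finite_fractions_bounded)
qed

lemma best_lower_approx3_minus:
  assumes "best_lower_approx3 \<alpha> p q"
  shows "best_upper_approx3 (- \<alpha>) (- p) q"
  unfolding best_upper_approx3_def
proof (intro conjI allI impI)
  show "q > 0" "0 \<le> (real q)\<^sup>2 * (real_of_int (- p) / real q - - \<alpha>)"
    using assms unfolding best_lower_approx3_def by (auto simp: algebra_simps)
  fix p' q'
  assume "q' > 0" "- \<alpha> \<le> real_of_int p' / real q'"
    "real_of_int p' / real q' \<noteq> real_of_int (- p) / real q" "q' \<le> q"
  then have "(real q)\<^sup>2 * (\<alpha> - real_of_int p / real q)
      < (real q')\<^sup>2 * (\<alpha> - real_of_int (- p') / real q')"
    using assms unfolding best_lower_approx3_def by (auto dest!: conjunct2 spec[of _ "- p'"])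
  then show "(real q)\<^sup>2 * (real_of_int (- p) / real q - - \<alpha>)
      < (real q')\<^sup>2 * (real_of_int p' / real q' - - \<alpha>)"
    by (simp add: algebra_simps)
qed

lemma finite_best_lower_approxs3:
  assumes "conj_rat \<alpha> \<beta>" "\<alpha> < \<beta>"
  shows "finite (best_lower_approxs3 \<alpha>)"
proof -
  have "conj_rat (- \<alpha>) (- \<beta>)"
    using assms(1) Rats_minus_iff[of "\<alpha> + \<beta>"] unfolding conj_rat_def by (simp add: algebra_simps)
  then have "finite (best_upper_approxs3 (- \<alpha>))"
    using finite_best_upper_approxs3 assms(2) by simp
  moreover have "best_lower_approxs3 \<alpha> \<subseteq> uminus ` best_upper_approxs3 (- \<alpha>)"
  proof
    fix z assume "z \<in> best_lower_approxs3 \<alpha>"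
    then obtain p q where "z = real_of_int p / real q" "best_lower_approx3 \<alpha> p q"
      unfolding best_lower_approxs3_def by blast
    then have "z = - (real_of_int (- p) / real q)" "best_upper_approx3 (- \<alpha>) (- p) q"
      using best_lower_approx3_minus by auto
    then show "z \<in> uminus ` best_upper_approxs3 (- \<alpha>)"
      unfolding best_upper_approxs3_def by blast
  qed
  ultimately show ?thesis
    using finite_surj by blast
qed

section \<open>Complete quotients\<close>

text \<open>The upper bound, uniform in \<open>n\<close>, later keeps the reciprocals of the
  convergents away from 0, so that their limit can be inverted.\<close>

lemma cfrac_convergent_bounds:
  assumes "\<And>j. a j \<ge> 1"
  shows "1 \<le> cfrac_convergent a n \<and> cfrac_convergent a n \<le> real_of_int (a 0) + 1"
  using assms
proof (induction n arbitrary: a)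
  case 0
  then show ?case by simp
next
  case (Suc n)
  have "1 \<le> cfrac_convergent (\<lambda>k. a (Suc k)) n"
    using Suc.IH[of "\<lambda>k. a (Suc k)"] Suc.prems by blast
  then have "0 \<le> 1 / cfrac_convergent (\<lambda>k. a (Suc k)) n" "1 / cfrac_convergent (\<lambda>k. a (Suc k)) n \<le> 1"
    by simp_all
  moreover have "1 \<le> real_of_int (a 0)"
    using Suc.prems[of 0] by simp
  ultimately show ?case
    unfolding cfrac_convergent.simps by linarith
qed

lemma regular_cfrac_tail:
  assumes "regular_cfrac a \<alpha>"
  obtains \<beta> where "regular_cfrac (\<lambda>k. a (Suc k)) \<beta>" "1 \<le> \<beta>" "\<alpha> = real_of_int (a 0) + 1 / \<beta>"
proof -
  define c where "c n = cfrac_convergent (\<lambda>k. a (Suc k)) n" for n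
  have pos: "\<And>j. a (Suc j) \<ge> 1"
    using assms unfolding regular_cfrac_def by simp
  have c: "1 \<le> c n" "c n \<le> real_of_int (a 1) + 1" for n
    using cfrac_convergent_bounds[of "\<lambda>k. a (Suc k)" n] pos unfolding c_def by auto
  have "(\<lambda>n. cfrac_convergent a (Suc n)) \<longlonglongrightarrow> \<alpha>"
    using assms LIMSEQ_Suc unfolding regular_cfrac_def by blast
  then have "(\<lambda>n. real_of_int (a 0) + 1 / c n - real_of_int (a 0)) \<longlonglongrightarrow> \<alpha> - real_of_int (a 0)"
    unfolding c_def cfrac_convergent.simps by (intro tendsto_diff tendsto_const)
  then have lim: "(\<lambda>n. 1 / c n) \<longlonglongrightarrow> \<alpha> - real_of_int (a 0)"
    by simp
  have "1 / (real_of_int (a 1) + 1) \<le> 1 / c n" for n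
    using c[of n] by (intro divide_left_mono) auto
  then have "1 / (real_of_int (a 1) + 1) \<le> \<alpha> - real_of_int (a 0)"
    by (intro LIMSEQ_le_const[OF lim]) auto
  moreover have "0 < 1 / (real_of_int (a 1) + 1)"
    using pos[of 0] by simp
  ultimately have nz: "\<alpha> - real_of_int (a 0) \<noteq> 0"
    by linarith
  have "(\<lambda>n. 1 / (1 / c n)) \<longlonglongrightarrow> 1 / (\<alpha> - real_of_int (a 0))"
    using lim nz by (intro tendsto_divide tendsto_const)
  then have "c \<longlonglongrightarrow> 1 / (\<alpha> - real_of_int (a 0))"
    by simp
  moreover from this have "1 \<le> 1 / (\<alpha> - real_of_int (a 0))"
    using c(1) by (intro LIMSEQ_le_const) auto
  ultimately show thesis
    using that[of "1 / (\<alpha> - real_of_int (a 0))"] pos nz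
    unfolding regular_cfrac_def c_def by simp
qed

text \<open>That each \<open>x j\<close> is the value of a shifted sequence is kept because it later
  turns the period of \<open>a\<close> into a period of \<open>x\<close>.\<close>

lemma regular_cfrac_complete_quotients:
  assumes "regular_cfrac a \<alpha>"
  obtains x where "x 0 = \<alpha>" "\<And>j. regular_cfrac (\<lambda>k. a (j + k)) (x j)"
    "\<And>j. x j = real_of_int (a j) + 1 / x (Suc j)" "\<And>j. 1 \<le> x (Suc j)"
proof -
  \<comment> \<open>As a limit, \<open>x j\<close> depends on the shifted sequence alone; uniqueness
    of limits identifies it with the tail from \<open>regular_cfrac_tail\<close>.\<close>
  define x where "x j = lim (cfrac_convergent (\<lambda>k. a (j + k)))" for j
  have x_eq: "x j = \<beta>" if "regular_cfrac (\<lambda>k. a (j + k)) \<beta>" for j \<beta>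
    using that limI unfolding x_def regular_cfrac_def by blast
  have step: "regular_cfrac (\<lambda>k. a (Suc j + k)) (x (Suc j)) \<and> 1 \<le> x (Suc j) \<and>
      x j = real_of_int (a j) + 1 / x (Suc j)" if reg: "regular_cfrac (\<lambda>k. a (j + k)) (x j)" for j
  proof -
    obtain \<beta> where "regular_cfrac (\<lambda>k. a (Suc j + k)) \<beta>" "1 \<le> \<beta>" "x j = real_of_int (a j) + 1 / \<beta>"
      using regular_cfrac_tail[OF reg] by auto
    then show ?thesis
      using x_eq[of "Suc j"] by auto
  qed
  have 0: "x 0 = \<alpha>"
    using assms x_eq[of 0] by simp
  have reg: "regular_cfrac (\<lambda>k. a (j + k)) (x j)" for j
  proof (induction j)
    case 0
    then show ?case using assms \<open>x 0 = \<alpha>\<close> by simp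
  next
    case (Suc j)
    then show ?case using step by blast
  qed
  then show thesis
    using that[of x] 0 step by blast
qed

section \<open>The conjugate of a periodic continued fraction\<close>

text \<open>Every solution of the recurrence \<open>z k = b k + 1 / z (k + 1)\<close> is carried from index \<open>k\<close> to
  index \<open>0\<close> by one and the same integer matrix, whence two distinct solutions that are both
  periodic yield conjugate numbers.\<close>

lemma cfrac_recurrence_moebius:
  fixes b :: "nat \<Rightarrow> int"
  assumes "\<And>k. b k \<ge> 1" "h > 0"
  shows "\<exists>A B C D :: int. C > 0 \<and> D \<ge> 0 \<and>
    (\<forall>z :: nat \<Rightarrow> real. (\<forall>k. z k * z (Suc k) = real_of_int (b k) * z (Suc k) + 1) \<longrightarrow>
      z 0 * (real_of_int C * z h + real_of_int D) = real_of_int A * z h + real_of_int B)"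
  using assms(2)
proof (induction h rule: nat_induct_non_zero)
  case 1
  \<comment> \<open>The matrix with rows \<open>(b 0, 1)\<close> and \<open>(1, 0)\<close>.\<close>
  show ?case
    by (intro exI[of _ "b 0"] exI[of _ 1] exI[of _ 1] exI[of _ 0]) auto
next
  case (Suc h)
  then obtain A B C D :: int where CD: "C > 0" "D \<ge> 0" and
    IH: "\<And>z :: nat \<Rightarrow> real. (\<forall>k. z k * z (Suc k) = real_of_int (b k) * z (Suc k) + 1) \<Longrightarrow>
      z 0 * (real_of_int C * z h + real_of_int D) = real_of_int A * z h + real_of_int B"
    by blast
  \<comment> \<open>The matrix is multiplied on the right by the one with rows
    \<open>(b h, 1)\<close> and \<open>(1, 0)\<close>. The bound \<open>D \<ge> 0\<close> keeps the
    new lower left entry positive, so that it can be divided by later.\<close>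
  show ?case
  proof (intro exI conjI allI impI)
    show "C * b h + D > 0" "C \<ge> 0"
      using CD assms(1)[of h] by (auto intro!: add_pos_nonneg mult_pos_pos)
    fix z :: "nat \<Rightarrow> real"
    assume z: "\<forall>k. z k * z (Suc k) = real_of_int (b k) * z (Suc k) + 1"
    have "real_of_int (C * b h + D) * z (Suc h) + real_of_int C
        = real_of_int C * (z h * z (Suc h)) + real_of_int D * z (Suc h)"
      using z by (simp add: algebra_simps)
    then have "z 0 * (real_of_int (C * b h + D) * z (Suc h) + real_of_int C)
        = z 0 * (real_of_int C * (z h * z (Suc h)) + real_of_int D * z (Suc h))"
      by (simp only:)
    also have "\<dots> = z 0 * (real_of_int C * z h + real_of_int D) * z (Suc h)"
      by (simp add: algebra_simps)
    also have "\<dots> = real_of_int A * (z h * z (Suc h)) + real_of_int B * z (Suc h)"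
      using IH[OF z] by (simp add: algebra_simps)
    also have "\<dots> = real_of_int (A * b h + B) * z (Suc h) + real_of_int A"
      using z by (simp add: algebra_simps)
    finally show "z 0 * (real_of_int (C * b h + D) * z (Suc h) + real_of_int C)
        = real_of_int (A * b h + B) * z (Suc h) + real_of_int A" .
  qed
qed

lemma conj_rat_periodic:
  fixes b :: "nat \<Rightarrow> int" and x y :: "nat \<Rightarrow> real"
  assumes "\<And>k. b k \<ge> 1" "h > 0"
    and x: "\<And>k. x k * x (Suc k) = real_of_int (b k) * x (Suc k) + 1" "x h = x 0"
    and y: "\<And>k. y k * y (Suc k) = real_of_int (b k) * y (Suc k) + 1" "y h = y 0"
    and "x 0 \<noteq> y 0"
  shows "conj_rat (x 0) (y 0)"
proof -
  obtain A B C D :: int where C: "C > 0" and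
    z: "\<And>z :: nat \<Rightarrow> real. (\<forall>k. z k * z (Suc k) = real_of_int (b k) * z (Suc k) + 1) \<Longrightarrow>
      z 0 * (real_of_int C * z h + real_of_int D) = real_of_int A * z h + real_of_int B"
    using cfrac_recurrence_moebius[of b h] assms(1,2) by blast
  have ex: "x 0 * (real_of_int C * x 0 + real_of_int D) = real_of_int A * x 0 + real_of_int B"
    using z[of x] x by simp
  have ey: "y 0 * (real_of_int C * y 0 + real_of_int D) = real_of_int A * y 0 + real_of_int B"
    using z[of y] y by simp
  \<comment> \<open>Both values are roots of \<open>C z^2 + (D - A) z - B\<close>; the difference of
    the two equations factors and gives the sum of the roots.\<close>
  have "(x 0 - y 0) * (real_of_int C * (x 0 + y 0) - (real_of_int A - real_of_int D)) = 0"
    using ex ey by (simp add: algebra_simps)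
  then have s: "real_of_int C * (x 0 + y 0) = real_of_int A - real_of_int D"
    using \<open>x 0 \<noteq> y 0\<close> by simp
  have "real_of_int C * (x 0 * y 0) = x 0 * (real_of_int C * (x 0 + y 0)) - real_of_int C * x 0 * x 0"
    by (simp add: algebra_simps)
  also have "\<dots> = - real_of_int B"
    unfolding s using ex by (simp add: algebra_simps)
  finally have "x 0 * y 0 = - real_of_int B / real_of_int C"
    using C by (simp add: field_simps)
  moreover have "x 0 + y 0 = (real_of_int A - real_of_int D) / real_of_int C"
    using s C by (simp add: field_simps)
  ultimately show ?thesis
    unfolding conj_rat_def by simp
qed

section \<open>Periodic orbits of the inverted recurrence\<close>

primrec conj_orbit :: "(nat \<Rightarrow> int) \<Rightarrow> real \<Rightarrow> nat \<Rightarrow> real" where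
  "conj_orbit b y 0 = y"
| "conj_orbit b y (Suc k) = 1 / (conj_orbit b y k - real_of_int (b k))"

text \<open>Solved for \<open>z (Suc k)\<close>, the recurrence maps [-1, 0] into itself, since
  \<open>y - b k \<le> -1\<close> there. Complete quotients in the period are at least 1, so an
  orbit in this interval is a different solution.\<close>

lemma conj_orbit_range:
  assumes "\<And>k. b k \<ge> 1" "-1 \<le> y" "y \<le> 0"
  shows "-1 \<le> conj_orbit b y k \<and> conj_orbit b y k \<le> 0"
proof (induction k)
  case 0
  then show ?case using assms by simp
next
  case (Suc k)
  have "conj_orbit b y k - real_of_int (b k) \<le> -1"
    using Suc assms(1)[of k] by linarith
  then show ?case
    by (auto simp: field_simps)
qed

lemma conj_orbit_Suc_neg:
  assumes "\<And>k. b k \<ge> 1" "-1 \<le> y" "y \<le> 0"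
  shows "conj_orbit b y (Suc k) < 0"
proof -
  have "conj_orbit b y k - real_of_int (b k) < 0"
    using conj_orbit_range[of b y k] assms assms(1)[of k] by fastforce
  then show ?thesis by simp
qed

text \<open>Running \<open>h\<close> steps is a continuous self-map of [-1, 0], which has a fixed
  point by the intermediate value theorem. The closed interval costs strict bounds;
  \<open>periodic_conjugate\<close> regains them.\<close>

lemma conj_orbit_periodic:
  assumes "\<And>k. b k \<ge> 1"
  obtains y where "-1 \<le> y" "y \<le> 0" "conj_orbit b y h = y"
proof -
  have cont: "continuous_on {-1..0} (\<lambda>y. conj_orbit b y k)" for k
  proof (induction k)
    case 0
    then show ?case by simp
  next
    case (Suc k)
    have "conj_orbit b y k - real_of_int (b k) \<noteq> 0" if "y \<in> {-1..0}" for y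
      using conj_orbit_range[of b y k] assms that[simplified] assms[of k] by fastforce
    then show ?case
      using Suc by (auto intro!: continuous_intros)
  qed
  have "\<exists>y\<ge>-1. y \<le> 0 \<and> y - conj_orbit b y h = 0"
  proof (rule IVT')
    show "-1 - conj_orbit b (-1) h \<le> 0" "0 \<le> 0 - conj_orbit b 0 h"
      using conj_orbit_range[of b "-1" h] conj_orbit_range[of b 0 h] assms by auto
    show "continuous_on {-1..0} (\<lambda>y. y - conj_orbit b y h)"
      by (intro continuous_intros cont)
  qed simp
  then show thesis
    using that by auto
qed

text \<open>In Galois' theorem \<open>- 1 / y\<close> is the value of the reversed period; only its integer part
  \<open>b (h - 1)\<close> matters here.\<close>

lemma periodic_conjugate:
  fixes b :: "nat \<Rightarrow> int" and x :: "nat \<Rightarrow> real"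
  assumes b: "\<And>k. b k \<ge> 1" and h: "h > 0"
    and x: "\<And>k. x k = real_of_int (b k) + 1 / x (Suc k)" "\<And>k. x k \<ge> 1" "x h = x 0"
  obtains y t where "conj_rat (x 0) y" "y < 0" "-1 < t" "t < 0" "1 / y = t - real_of_int (b (h - 1))"
proof -
  obtain y where y: "-1 \<le> y" "y \<le> 0" "conj_orbit b y h = y"
    using b by (rule conj_orbit_periodic)
  obtain g where g: "h = Suc g"
    using h gr0_implies_Suc by blast
  have neg_Suc: "conj_orbit b y (Suc k) < 0" for k
    using conj_orbit_Suc_neg b y(1,2) by blast
  \<comment> \<open>The cycle closes: \<open>y\<close> is also the value at \<open>Suc g\<close>, so
    what holds at successor indices holds at index 0.\<close>
  have y0: "y < 0"
    using neg_Suc[of g] y(3) g by (simp del: conj_orbit.simps)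
  have neg: "conj_orbit b y k < 0" for k
    using neg_Suc y0 by (cases k) auto
  have rec: "conj_orbit b y k = real_of_int (b k) + 1 / conj_orbit b y (Suc k)" for k
    by simp
  have gt_Suc: "-1 < conj_orbit b y (Suc k)" for k
  proof -
    \<comment> \<open>The value -1 here would force the value \<open>b k - 1 \<ge> 0\<close> at
      index \<open>k\<close>.\<close>
    have "conj_orbit b y (Suc k) \<noteq> -1"
      using rec[of k] neg[of k] b[of k] by (auto simp del: conj_orbit.simps)
    then show ?thesis
      using conj_orbit_range[of b y "Suc k"] b y(1,2) by fastforce
  qed
  have gt: "-1 < conj_orbit b y k" for k
    using gt_Suc[of g] gt_Suc[of "k - 1"] y(3) g by (cases k) (simp_all del: conj_orbit.simps(2))
  have "conj_rat (x 0) (conj_orbit b y 0)"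
  proof (rule conj_rat_periodic[of b h, OF b h])
    show "x k * x (Suc k) = real_of_int (b k) * x (Suc k) + 1" for k
      using x(1)[of k] x(2)[of "Suc k"] by (simp add: field_simps)
    show "conj_orbit b y k * conj_orbit b y (Suc k) = real_of_int (b k) * conj_orbit b y (Suc k) + 1"
      for k
      using rec[of k] neg[of "Suc k"] by (simp add: field_simps del: conj_orbit.simps)
    show "x 0 \<noteq> conj_orbit b y 0"
      using x(2)[of 0] y0 by simp
  qed (use x(3) y(3) in simp_all)
  \<comment> \<open>The witness for \<open>t\<close> is the orbit value at \<open>h - 1\<close>,
    just before the cycle returns to \<open>y\<close>.\<close>
  moreover have "1 / y = conj_orbit b y g - real_of_int (b (h - 1))"
    using rec[of g] y(3) g by (simp del: conj_orbit.simps)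
  ultimately show thesis
    using that[of y "conj_orbit b y g"] y0 gt[of g] neg[of g] by simp
qed

section \<open>Carrying the conjugate back through the preperiod\<close>

lemma conj_rat_step:
  fixes a :: int
  assumes "conj_rat x y" "x \<noteq> 0" "y \<noteq> 0"
  shows "conj_rat (real_of_int a + 1 / x) (real_of_int a + 1 / y)"
proof -
  have "(real_of_int a + 1 / x) + (real_of_int a + 1 / y) = 2 * real_of_int a + (x + y) / (x * y)"
    using assms(2,3) by (simp add: field_simps)
  moreover have "(real_of_int a + 1 / x) * (real_of_int a + 1 / y)
      = (real_of_int a)\<^sup>2 + real_of_int a * ((x + y) / (x * y)) + 1 / (x * y)"
    using assms(2,3) by (simp add: field_simps power2_eq_square)
  ultimately show ?thesis
    using assms(1) unfolding conj_rat_def by simp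
qed

text \<open>On positive reals \<open>a + 1 / z\<close> decreases in \<open>z\<close>, so each step
  back swaps the order and the parity of \<open>n\<close> counts the swaps. Positivity survives down
  to index 1; \<open>a 0\<close> may be nonpositive, but no step follows index 0, hence the form of
  the last premise.\<close>

lemma conj_rat_descend:
  fixes a :: "nat \<Rightarrow> int" and x :: "nat \<Rightarrow> real"
  assumes a: "\<And>j. a (Suc j) \<ge> 1"
    and x: "\<And>j. x j = real_of_int (a j) + 1 / x (Suc j)" "\<And>j. x (Suc j) \<ge> 1"
    and "conj_rat (x n) y" "y \<noteq> x n" "n = 0 \<or> y > 0"
  shows "\<exists>y'. conj_rat (x 0) y' \<and> y' \<noteq> x 0 \<and> (y' < x 0 \<longleftrightarrow> (even n \<longleftrightarrow> y < x n))"
  using assms(4-)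
proof (induction n arbitrary: y)
  case 0
  then show ?case by auto
next
  case (Suc n)
  define y1 where "y1 = real_of_int (a n) + 1 / y"
  have pos: "y > 0" "x (Suc n) > 0"
    using Suc.prems(3) x(2)[of n] by simp_all
  have "conj_rat (x n) y1"
    unfolding y1_def x(1)[of n] using Suc.prems(1) pos by (intro conj_rat_step) auto
  moreover have lt: "y1 < x n \<longleftrightarrow> x (Suc n) < y" and "y1 \<noteq> x n"
    unfolding y1_def x(1)[of n] using Suc.prems(2) pos by (auto simp: field_simps)
  moreover have "n = 0 \<or> y1 > 0"
    using a[of "n - 1"] pos unfolding y1_def by (cases n) (auto intro!: add_pos_pos)
  ultimately obtain y' where "conj_rat (x 0) y'" "y' \<noteq> x 0" "y' < x 0 \<longleftrightarrow> (even n \<longleftrightarrow> y1 < x n)"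
    using Suc.IH by blast
  then show ?case
    using lt Suc.prems(2) by (intro exI[of _ y']) auto
qed

text \<open>As \<open>-1 < t < 0\<close>, the conjugate \<open>w\<close> of \<open>x m\<close> has
  the sign of \<open>a m - a (m + h)\<close> when this is nonzero. If positive, the descent starts
  at \<open>m\<close>. If negative, even \<open>w < -1\<close>, and one more step back allows the
  descent to start at \<open>m - 1\<close>; this shift makes the parity condition change with the
  sign.\<close>

lemma periodic_cfrac_conjugate:
  assumes "periodic_cfrac a m h \<alpha>" "m = 0 \<or> a m \<noteq> a (m + h)"
  obtains \<beta> where "conj_rat \<alpha> \<beta>" "\<beta> \<noteq> \<alpha>"
    "\<beta> < \<alpha> \<longleftrightarrow> m = 0 \<or> (odd m \<longleftrightarrow> a m < a (m + h))"
proof -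
  have reg: "regular_cfrac a \<alpha>" and h: "h > 0" and per: "\<And>j. j > m \<Longrightarrow> a (j + h) = a j"
    using assms(1) unfolding periodic_cfrac_def by auto
  have pos: "a (Suc j) \<ge> 1" for j
    using reg unfolding regular_cfrac_def by simp
  obtain x where x0: "x 0 = \<alpha>" and xreg: "\<And>j. regular_cfrac (\<lambda>k. a (j + k)) (x j)"
    and x: "\<And>j. x j = real_of_int (a j) + 1 / x (Suc j)" "\<And>j. 1 \<le> x (Suc j)"
    using regular_cfrac_complete_quotients[OF reg] by blast
  have "(\<lambda>k. a (Suc m + h + k)) = (\<lambda>k. a (Suc m + k))"
    using per[of "Suc m + _"] by (simp add: ac_simps)
  then have xper: "x (Suc m + h) = x (Suc m)"
    using xreg[of "Suc m + h"] xreg[of "Suc m"] LIMSEQ_unique unfolding regular_cfrac_def by metis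
  define b X where "b k = a (Suc m + k)" and "X k = x (Suc m + k)" for k
  have "b k \<ge> 1" "X k \<ge> 1" for k
    using pos x(2) unfolding b_def X_def by simp_all
  moreover have "X k = real_of_int (b k) + 1 / X (Suc k)" for k
    using x(1)[of "Suc m + k"] unfolding b_def X_def by simp
  moreover have "X h = X 0"
    using xper unfolding X_def by simp
  ultimately obtain y t where "conj_rat (X 0) y" and y: "y < 0" and t: "-1 < t" "t < 0"
    and "1 / y = t - real_of_int (b (h - 1))"
    using h periodic_conjugate[of b h X] by blast
  \<comment> \<open>Index \<open>h - 1\<close> of the shifted sequence is index \<open>m + h\<close>
    of \<open>a\<close>, which is why \<open>a m\<close> is compared with exactly this term.\<close>
  then have cy: "conj_rat (x (Suc m)) y" and yt: "1 / y = t - real_of_int (a (m + h))"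
    using h unfolding b_def X_def by simp_all
  define w where "w = real_of_int (a m) + 1 / y"
  have w: "w = real_of_int (a m - a (m + h)) + t"
    unfolding w_def yt by simp
  have cw: "conj_rat (x m) w"
    unfolding w_def x(1)[of m] using cy y x(2)[of m] by (intro conj_rat_step) auto
  have "1 / y < 0" "0 < 1 / x (Suc m)"
    using y x(2)[of m] by auto
  then have w_lt: "w < x m"
    unfolding w_def x(1)[of m] by linarith
  show thesis
  proof (cases m)
    case 0
    then show thesis
      using that[of w] cw w_lt x0 by simp
  next
    case (Suc n)
    show thesis
    proof (cases "a m < a (m + h)")
      case True
      then have w_neg: "w < -1"
        unfolding w using t by linarith
      define v where "v = real_of_int (a n) + 1 / w"
      \<comment> \<open>From \<open>-1 < 1 / w < 0\<close> follow \<open>v < a n < x n\<close> and,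
        when \<open>a n \<ge> 1\<close>, also \<open>v > 0\<close>.\<close>
      have "1 / w < 0" "-1 < 1 / w" "0 < 1 / x (Suc n)"
        using w_neg x(2)[of n] Suc by (auto simp: field_simps)
      moreover have "n = 0 \<or> real_of_int (a n) \<ge> 1"
        using pos[of "n - 1"] by (cases n) simp_all
      ultimately have "v < x n" "n = 0 \<or> v > 0"
        unfolding v_def x(1)[of n] by linarith+
      moreover have "conj_rat (x n) v"
        unfolding v_def x(1)[of n] using cw w_neg x(2)[of n] Suc by (intro conj_rat_step) auto
      ultimately obtain \<beta> where "conj_rat (x 0) \<beta>" "\<beta> \<noteq> x 0" "\<beta> < x 0 \<longleftrightarrow> even n"
        using conj_rat_descend[of a x n v, OF pos x] by blast
      then show thesis
        using that[of \<beta>] True Suc x0 by simp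
    next
      case False
      then have gt: "a (m + h) < a m"
        using assms(2) Suc by auto
      then have "w > 0"
        unfolding w using t by linarith
      then obtain \<beta> where "conj_rat (x 0) \<beta>" "\<beta> \<noteq> x 0" "\<beta> < x 0 \<longleftrightarrow> even m"
        using conj_rat_descend[of a x m w, OF pos x cw] w_lt by blast
      then show thesis
        using that[of \<beta>] False Suc x0 by simp
    qed
  qed
qed

section \<open>Quadratic irrationals and the conclusion\<close>

lemma quadratic_irrational_conjugate:
  assumes "quadratic_irrational \<alpha>"
  obtains \<beta> where "conj_rat \<alpha> \<beta>" "\<beta> \<noteq> \<alpha>"
proof -
  obtain u v where irr: "\<alpha> \<notin> \<rat>" and uv: "u \<in> \<rat>" "v \<in> \<rat>" "\<alpha>\<^sup>2 + u * \<alpha> + v = 0"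
    using assms unfolding quadratic_irrational_def by blast
  have "\<alpha> * (- u - \<alpha>) = v"
    using uv(3) by (simp add: algebra_simps power2_eq_square)
  then have "conj_rat \<alpha> (- u - \<alpha>)"
    using uv unfolding conj_rat_def by simp
  moreover have "- u - \<alpha> \<noteq> \<alpha>"
  proof
    assume "- u - \<alpha> = \<alpha>"
    then have "\<alpha> = - u / 2"
      by simp
    moreover have "- u / 2 \<in> \<rat>"
      using uv(1) by simp
    ultimately show False
      using irr by simp
  qed
  ultimately show thesis
    using that by blast
qed

theorem theorem5:
  shows "(\<forall>(a :: nat \<Rightarrow> int) (m :: nat) (h :: nat) (\<alpha> :: real). periodic_cfrac a m h \<alpha> \<longrightarrow>
            (m = 0 \<or> (odd m \<and> a m < a (m + h)) \<or> (even m \<and> m \<noteq> 0 \<and> a m > a (m + h))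
               \<longrightarrow> finite (best_upper_approxs3 \<alpha>)) \<and>
            ((odd m \<and> a m > a (m + h)) \<or> (even m \<and> m \<noteq> 0 \<and> a m < a (m + h))
               \<longrightarrow> finite (best_lower_approxs3 \<alpha>))) \<and>
         (\<forall>\<alpha> :: real. quadratic_irrational \<alpha> \<longrightarrow>
            \<not> (infinite (best_lower_approxs3 \<alpha>) \<and> infinite (best_upper_approxs3 \<alpha>)))"
proof (intro conjI allI impI)
  fix a :: "nat \<Rightarrow> int" and m h :: nat and \<alpha> :: real
  assume per: "periodic_cfrac a m h \<alpha>"
  show "finite (best_upper_approxs3 \<alpha>)"
    if c: "m = 0 \<or> (odd m \<and> a m < a (m + h)) \<or> (even m \<and> m \<noteq> 0 \<and> a m > a (m + h))"
  proof -
    have "m = 0 \<or> a m \<noteq> a (m + h)"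
      using c by auto
    then obtain \<beta> where "conj_rat \<alpha> \<beta>" "\<beta> < \<alpha> \<longleftrightarrow> m = 0 \<or> (odd m \<longleftrightarrow> a m < a (m + h))"
      using periodic_cfrac_conjugate[OF per] by blast
    then show ?thesis
      using c by (intro finite_best_upper_approxs3[of \<alpha> \<beta>]) auto
  qed
  show "finite (best_lower_approxs3 \<alpha>)"
    if c: "(odd m \<and> a m > a (m + h)) \<or> (even m \<and> m \<noteq> 0 \<and> a m < a (m + h))"
  proof -
    have "m = 0 \<or> a m \<noteq> a (m + h)"
      using c by auto
    then obtain \<beta> where \<beta>: "conj_rat \<alpha> \<beta>" "\<beta> \<noteq> \<alpha>"
        "\<beta> < \<alpha> \<longleftrightarrow> m = 0 \<or> (odd m \<longleftrightarrow> a m < a (m + h))"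
      using periodic_cfrac_conjugate[OF per] by blast
    moreover have "\<not> (m = 0 \<or> (odd m \<longleftrightarrow> a m < a (m + h)))"
      using c by (auto intro!: Nat.gr0I)
    ultimately show ?thesis
      by (intro finite_best_lower_approxs3[of \<alpha> \<beta>]) auto
  qed
next
  fix \<alpha> :: real
  assume "quadratic_irrational \<alpha>"
  then obtain \<beta> where "conj_rat \<alpha> \<beta>" "\<beta> \<noteq> \<alpha>"
    using quadratic_irrational_conjugate by blast
  \<comment> \<open>Whichever side of \<alpha> the conjugate lies on, one of the two sets is
    finite.\<close>
  then show "\<not> (infinite (best_lower_approxs3 \<alpha>) \<and> infinite (best_upper_approxs3 \<alpha>))"
    using finite_best_upper_approxs3 finite_best_lower_approxs3 by (cases "\<beta> < \<alpha>") auto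
qed

end
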